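(* Let $R>1$ and let $\Omega=\{z\in\mathbb{C}: |z|<R\}$. Let $\varepsilon\in(0,1)$ and let $g$ be analytic in $\Omega$ with $\|g\|_R\le 1$ and $\|g\|_1\le \varepsilon$. Then for any $z$ with $1<|z|<R$, $$\log|g(z)|\le \alpha(z)\log\varepsilon,\quad\text{i.e.,}\quad |g(z)|\le \varepsilon^{\alpha(z)},$$ where $$\alpha(z)=1-\frac{\log|z|}{\log R}.$$ Conversely, for each $R>1$ there is an infinite sequence of values $\varepsilon\in(0,1)$ converging to $0$ such that, for each $\varepsilon$ in the sequence, there is a function $g$ analytic in $\Omega$ with $\|g\|_R\le 1$ and $\|g\|_1\le\varepsilon$ for which $|g(z)|=\varepsilon^{\alpha(z)}$ (equivalently $\log|g(z)|=\alpha(z)\log\varepsilon$) for all $z$ with $1<|z|<R$.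
   Context: For $r>0$, $\|\cdot\|_r$ denotes the supremum norm over the disk $\{z\in\mathbb{C}: |z|<r\}$, i.e. $\|g\|_r=\sup_{|z|<r}|g(z)|$. The convention $\log 0=-\infty$ is used. *)

theory Defs
  imports "HOL-Analysis.Analysis"
begin

(* Extended-real valued: for g unbounded on the disk the supremum is \<infinity>,
   so a finite bound on disk_norm r g really is a bound on g. *)
definition disk_norm :: "real \<Rightarrow> (complex \<Rightarrow> complex) \<Rightarrow> ereal" where
  "disk_norm r g = (SUP z\<in>ball 0 r. ereal (cmod (g z)))"

(* Natural logarithm with the convention log 0 = -\<infinity> (the library has ln 0 = 0).
   Only meant for nonnegative arguments. *)
definition elog :: "real \<Rightarrow> ereal" where
  "elog x = (if x \<le> 0 then - \<infinity> else ereal (ln x))"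

definition alpha :: "real \<Rightarrow> complex \<Rightarrow> real" where
  "alpha R z = 1 - ln (cmod z) / ln R"

end

theory Submission
  imports Defs "HOL-Complex_Analysis.Complex_Analysis"
begin

text \<open>
  The upper bound is Hadamard's three circles argument in a form that avoids logarithms of
  subharmonic functions: if \<open>R ^ p * \<epsilon> ^ q \<le> 1\<close>, the maximum principle for \<open>g ^ q / z ^ p\<close> on the
  annulus \<open>1 < \<bar>z\<bar> < r\<close>, with \<open>r\<close> tending to \<open>R\<close>, gives \<open>\<bar>g z\<bar> ^ q \<le> (\<bar>z\<bar> / R) ^ p\<close>. Letting
  \<open>p / q\<close> increase to \<open>- ln \<epsilon> / ln R\<close> yields the claim. Equality holds for the
  monomials \<open>(z / R) ^ n\<close> with \<open>\<epsilon> = R ^ (- n)\<close>.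
\<close>

lemma disk_norm_le_iff:
  "disk_norm r g \<le> ereal B \<longleftrightarrow> (\<forall>z\<in>ball 0 r. cmod (g z) \<le> B)"
  by (simp add: disk_norm_def SUP_le_iff)

text \<open>A frontier point satisfies both weak inequalities by closedness, but not both strict
  ones by openness. This reduces the maximum principle on an annulus to estimates on two
  circles.\<close>

lemma frontier_annulus_subset:
  fixes a b :: real
  shows "frontier {z::complex. a < cmod z \<and> cmod z < b} \<subseteq> sphere 0 a \<union> sphere 0 b"
proof -
  let ?S = "{z::complex. a < cmod z \<and> cmod z < b}"
  have "open ?S"
    by (intro open_Collect_conj open_Collect_less continuous_intros)
  moreover have "closed {z::complex. a \<le> cmod z \<and> cmod z \<le> b}"
    by (intro closed_Collect_conj closed_Collect_le continuous_intros)
  then have "closure ?S \<subseteq> {z. a \<le> cmod z \<and> cmod z \<le> b}"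
    by (intro closure_minimal) auto
  ultimately show ?thesis
    by (auto simp: frontier_def interior_open)
qed

text \<open>Integer exponents keep \<open>g w ^ q / w ^ p\<close> single-valued, and its possible
  pole at 0 lies off the annulus. On the unit circle it is bounded by \<open>\<epsilon> ^ q\<close>,
  hence by \<open>(1 / r) ^ p\<close> through the hypothesis on \<open>p\<close> and
  \<open>q\<close>; on the circle of radius \<open>r\<close> the bound \<open>(1 / r) ^ p\<close>
  comes from \<open>cmod (g w) \<le> 1\<close>. The radius \<open>r\<close> stays below
  \<open>R\<close> because \<open>g\<close> need not extend to the circle of radius
  \<open>R\<close>.\<close>

lemma three_circles_power_aux:
  fixes g :: "complex \<Rightarrow> complex"
  assumes hol: "g holomorphic_on ball 0 R"
    and le1: "\<And>z. cmod z < R \<Longrightarrow> cmod (g z) \<le> 1"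
    and le_eps: "\<And>z. cmod z < 1 \<Longrightarrow> cmod (g z) \<le> \<epsilon>"
    and pq: "R ^ p * \<epsilon> ^ q \<le> 1" and eps: "0 \<le> \<epsilon>"
    and z: "1 < cmod z" "cmod z < r" and r: "r < R"
  shows "cmod (g z) ^ q \<le> (cmod z / r) ^ p"
proof -
  let ?S = "{z::complex. 1 < cmod z \<and> cmod z < r}"
  let ?h = "\<lambda>w. g w ^ q / w ^ p"
  have r1: "1 < r" using z by simp
  have cl: "closure ?S \<subseteq> {w. 1 \<le> cmod w \<and> cmod w \<le> r}"
    by (intro closure_minimal closed_Collect_conj closed_Collect_le continuous_intros) auto
  have cont: "continuous_on (ball 0 R) g"
    using hol by (rule holomorphic_on_imp_continuous_on)
  have hol_h: "?h holomorphic_on (ball 0 R - {0})"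
    by (intro holomorphic_intros holomorphic_on_subset[OF hol]) auto
  have sub: "closure ?S \<subseteq> ball 0 R - {0}"
    using cl r by fastforce
  \<comment> \<open>The bound on the open unit disk passes to its boundary by continuity, since the
    closed disk lies inside \<open>ball 0 R\<close>.\<close>
  have circle: "cmod (g w) \<le> \<epsilon>" if "cmod w = 1" for w
  proof (rule continuous_on_closure_norm_le[of "ball 0 1" g \<epsilon> w])
    show "continuous_on (closure (ball 0 1)) g"
      using r r1 by (intro continuous_on_subset[OF cont]) auto
  qed (use that le_eps in auto)
  have "cmod (?h z) \<le> (1 / r) ^ p"
  proof (rule maximum_modulus_frontier[of ?h ?S])
    show "?h holomorphic_on interior ?S"
      using sub interior_subset[of ?S] closure_subset[of ?S]
      by (intro holomorphic_on_subset[OF hol_h]) blast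
    show "continuous_on (closure ?S) ?h"
      using sub hol_h by (meson continuous_on_subset holomorphic_on_imp_continuous_on)
    show "bounded ?S"
      by (rule bounded_subset[of "ball 0 r"]) auto
    show "z \<in> ?S" using z by simp
    show "cmod (?h w) \<le> (1 / r) ^ p" if w: "w \<in> frontier ?S" for w
    proof -
      consider "cmod w = 1" | "cmod w = r"
        using subsetD[OF frontier_annulus_subset w] by auto
      then show ?thesis
      proof cases
        case 1
        have "r ^ p * cmod (g w) ^ q \<le> R ^ p * \<epsilon> ^ q"
          using circle[OF 1] r r1 eps by (intro mult_mono power_mono) auto
        with pq have "r ^ p * cmod (g w) ^ q \<le> 1" by linarith
        then show ?thesis
          using 1 r1 by (simp add: norm_divide norm_power power_divide field_simps)
      next
        case 2
        then have "cmod (g w) ^ q \<le> 1"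
          using le1[of w] r by (simp add: power_le_one)
        then show ?thesis
          using 2 r1 by (simp add: norm_divide norm_power power_divide divide_right_mono)
      qed
    qed
  qed
  moreover have "z \<noteq> 0" using z by auto
  ultimately show ?thesis
    using r1 by (simp add: norm_divide norm_power power_divide field_simps)
qed

lemma three_circles_power:
  fixes g :: "complex \<Rightarrow> complex"
  assumes "g holomorphic_on ball 0 R"
    and "\<And>z. cmod z < R \<Longrightarrow> cmod (g z) \<le> 1"
    and "\<And>z. cmod z < 1 \<Longrightarrow> cmod (g z) \<le> \<epsilon>"
    and "R ^ p * \<epsilon> ^ q \<le> 1" and "0 \<le> \<epsilon>"
    and z: "1 < cmod z" "cmod z < R"
  shows "cmod (g z) ^ q \<le> (cmod z / R) ^ p"
proof (rule tendsto_lowerbound)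
  show "((\<lambda>r. (cmod z / r) ^ p) \<longlongrightarrow> (cmod z / R) ^ p) (at_left R)"
    using z by (auto intro!: tendsto_eq_intros)
  show "\<forall>\<^sub>F r in at_left R. cmod (g z) ^ q \<le> (cmod z / r) ^ p"
    using eventually_at_left_real[OF z(2)]
    by eventually_elim (rule three_circles_power_aux[of g R \<epsilon>], use assms in auto)
qed simp

text \<open>The sharp exponent \<open>b\<close> solves \<open>R powr b * \<epsilon> = 1\<close> and
  may be irrational, so it is approximated from below by fractions \<open>p / q\<close>. The
  resulting error, of order \<open>1 / q\<close>, cannot hide a fixed violation of the
  bound.\<close>

lemma three_circles_ln:
  fixes g :: "complex \<Rightarrow> complex"
  assumes R: "1 < R" and hol: "g holomorphic_on ball 0 R"
    and le1: "\<And>z. cmod z < R \<Longrightarrow> cmod (g z) \<le> 1"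
    and le_eps: "\<And>z. cmod z < 1 \<Longrightarrow> cmod (g z) \<le> \<epsilon>"
    and eps: "0 < \<epsilon>" "\<epsilon> < 1"
    and z: "1 < cmod z" "cmod z < R" and nz: "g z \<noteq> 0"
  shows "ln (cmod (g z)) \<le> alpha R z * ln \<epsilon>"
proof (rule ccontr)
  define b where "b = - ln \<epsilon> / ln R"
  define L where "L = ln (cmod z) - ln R"
  have lnR: "ln R > 0" using R by simp
  have b: "b \<ge> 0" using eps lnR by (simp add: b_def divide_nonpos_pos)
  have "ln (cmod z) < ln R"
    using z R by (subst ln_less_cancel_iff) auto
  then have L: "L < 0" by (simp add: L_def)
  have bL: "alpha R z * ln \<epsilon> = b * L"
    using lnR by (simp add: alpha_def b_def L_def field_simps)
  assume "\<not> ?thesis"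
  then have pos: "ln (cmod (g z)) - b * L > 0" by (simp add: bL)
  \<comment> \<open>Rounding \<open>real q * b\<close> down to \<open>p\<close> costs at most
    \<open>- L\<close> in the final estimate, so \<open>q\<close> is taken large enough for the
    supposed excess, multiplied by \<open>q\<close>, to outweigh that.\<close>
  obtain q :: nat where q: "real q * (ln (cmod (g z)) - b * L) > - L"
    using reals_Archimedean3[OF pos] by blast
  \<comment> \<open>Rounding down, rather than up, ensures
    \<open>R ^ p * \<epsilon> ^ q \<le> 1\<close>.\<close>
  define p where "p = nat \<lfloor>real q * b\<rfloor>"
  have p: "real p \<le> real q * b" "real q * b - 1 \<le> real p"
    using b by (auto simp: p_def)
  have "ln (R ^ p * \<epsilon> ^ q) = real p * ln R + real q * ln \<epsilon>"
    using R eps by (simp add: ln_mult ln_realpow)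
  also have "\<dots> \<le> real q * b * ln R + real q * ln \<epsilon>"
    using p(1) lnR by (simp add: mult_right_mono)
  also have "\<dots> = 0" using lnR by (simp add: b_def)
  finally have "R ^ p * \<epsilon> ^ q \<le> 1"
    using R eps by (simp add: ln_le_zero_iff)
  then have "cmod (g z) ^ q \<le> (cmod z / R) ^ p"
    using three_circles_power[of g R \<epsilon> p q z] hol le1 le_eps eps z by simp
  moreover have pos_ratio: "0 < cmod z / R"
    using z(1) R by (intro divide_pos_pos) linarith+
  ultimately have "ln (cmod (g z) ^ q) \<le> ln ((cmod z / R) ^ p)"
    using nz by (subst ln_le_cancel_iff) (auto intro: zero_less_power simp del: zero_less_divide_iff)
  moreover have "ln (cmod z / R) = L"
    using pos_ratio R unfolding L_def by (subst ln_div) (auto simp: zero_less_divide_iff)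
  ultimately have "real q * ln (cmod (g z)) \<le> real p * L"
    using z R nz by (simp add: ln_realpow)
  also have "\<dots> \<le> (real q * b - 1) * L"
    using p(2) L by (intro mult_right_mono_neg) auto
  finally show False using q by (simp add: algebra_simps)
qed

lemma elog_pos: "0 < x \<Longrightarrow> elog x = ereal (ln x)"
  by (simp add: elog_def)

text \<open>Since \<open>ln (cmod z) / ln R\<close> is the logarithm of \<open>cmod z\<close> to
  base \<open>R\<close>, raising \<open>1 / R\<close> to the power \<open>alpha R z\<close> gives
  exactly \<open>cmod z / R\<close>.\<close>

lemma monomial_eq_powr_alpha:
  assumes R: "1 < R" and z: "0 < cmod z"
  shows "(cmod z / R) ^ n = ((1 / R) ^ n) powr alpha R z"
proof -
  have "alpha R z * ln ((1 / R) ^ n) = real n * ln (cmod z / R)"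
    using R z by (simp add: alpha_def ln_realpow ln_div field_simps)
  then have "((1 / R) ^ n) powr alpha R z = (cmod z / R) powr real n"
    using R z by (simp add: powr_def)
  then show ?thesis
    using R z by (simp add: powr_realpow)
qed

theorem theorem3p1:
  fixes R :: real
  assumes "R > 1"
  shows "(\<forall>(\<epsilon>::real) (g::complex \<Rightarrow> complex).
            0 < \<epsilon> \<and> \<epsilon> < 1 \<and> g analytic_on ball 0 R \<and>
            disk_norm R g \<le> 1 \<and> disk_norm 1 g \<le> ereal \<epsilon> \<longrightarrow>
            (\<forall>z. 1 < cmod z \<and> cmod z < R \<longrightarrow>
               elog (cmod (g z)) \<le> ereal (alpha R z) * elog \<epsilon> \<and>
               cmod (g z) \<le> \<epsilon> powr alpha R z)) \<and>
         (\<exists>e :: nat \<Rightarrow> real.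
            (\<forall>n. 0 < e n \<and> e n < 1) \<and> e \<longlonglongrightarrow> 0 \<and>
            (\<forall>n. \<exists>g::complex \<Rightarrow> complex.
               g analytic_on ball 0 R \<and>
               disk_norm R g \<le> 1 \<and> disk_norm 1 g \<le> ereal (e n) \<and>
               (\<forall>z. 1 < cmod z \<and> cmod z < R \<longrightarrow>
                  cmod (g z) = e n powr alpha R z \<and>
                  elog (cmod (g z)) = ereal (alpha R z) * elog (e n))))"
proof (intro conjI allI impI; (elim conjE)?)
  fix \<epsilon> :: real and g :: "complex \<Rightarrow> complex" and z :: complex
  assume eps: "0 < \<epsilon>" "\<epsilon> < 1" and an: "g analytic_on ball 0 R"
    and "disk_norm R g \<le> 1" "disk_norm 1 g \<le> ereal \<epsilon>"
    and z: "1 < cmod z" "cmod z < R"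
  then have le: "\<And>w. cmod w < R \<Longrightarrow> cmod (g w) \<le> 1" "\<And>w. cmod w < 1 \<Longrightarrow> cmod (g w) \<le> \<epsilon>"
    using disk_norm_le_iff[of R g 1] disk_norm_le_iff[of 1 g \<epsilon>] by (auto simp: one_ereal_def)
  have ln_le: "ln (cmod (g z)) \<le> alpha R z * ln \<epsilon>" if "g z \<noteq> 0"
    using three_circles_ln[OF assms analytic_imp_holomorphic[OF an] le eps z that] .
  \<comment> \<open>At a zero of \<open>g\<close> the left side is \<open>- \<infinity>\<close>, so
    the real logarithm is needed only elsewhere.\<close>
  then show "elog (cmod (g z)) \<le> ereal (alpha R z) * elog \<epsilon>"
    using eps by (cases "g z = 0") (auto simp: elog_def)
  show "cmod (g z) \<le> \<epsilon> powr alpha R z"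
    using ln_le eps by (cases "g z = 0") (auto simp: powr_def ln_ge_iff ln_le_cancel_iff[symmetric] simp del: ln_le_cancel_iff)
next
  \<comment> \<open>The exponent starts at 1, because exponent 0 would give the excluded value
    1.\<close>
  define e where "e n = (1 / R) ^ Suc n" for n
  have e: "0 < e n" "e n < 1" for n
    using assms by (auto simp: e_def power_less_one_iff simp del: power_Suc)
  have "e \<longlonglongrightarrow> 0"
    unfolding e_def using assms by (intro LIMSEQ_Suc LIMSEQ_realpow_zero) auto
  moreover have "\<exists>g. g analytic_on ball 0 R \<and>
      disk_norm R g \<le> 1 \<and> disk_norm 1 g \<le> ereal (e n) \<and>
      (\<forall>z. 1 < cmod z \<and> cmod z < R \<longrightarrow>
         cmod (g z) = e n powr alpha R z \<and>
         elog (cmod (g z)) = ereal (alpha R z) * elog (e n))" for n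
  proof (intro exI[of _ "\<lambda>z. (z / of_real R) ^ Suc n"] conjI allI impI)
    let ?g = "\<lambda>z::complex. (z / of_real R) ^ Suc n"
    have norm_g: "cmod (?g z) = (cmod z / R) ^ Suc n" for z
      using assms by (simp only: norm_power norm_divide norm_of_real abs_of_pos)
    show "?g analytic_on ball 0 R"
      using assms by (intro analytic_intros) auto
    have "\<forall>z\<in>ball 0 R. cmod (?g z) \<le> 1"
      using assms unfolding norm_g by (intro ballI power_le_one) auto
    then show "disk_norm R ?g \<le> 1"
      using disk_norm_le_iff[of R ?g 1] by (simp add: one_ereal_def)
    show "disk_norm 1 ?g \<le> ereal (e n)"
      using assms unfolding disk_norm_le_iff norm_g e_def
      by (intro ballI power_mono) (auto simp: divide_right_mono)
    fix z assume z: "1 < cmod z \<and> cmod z < R"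
    then have "0 < cmod z" by linarith
    with assms show eq: "cmod (?g z) = e n powr alpha R z"
      unfolding norm_g e_def by (rule monomial_eq_powr_alpha)
    show "elog (cmod (?g z)) = ereal (alpha R z) * elog (e n)"
      using e[of n] unfolding eq by (simp add: elog_pos ln_powr)
  qed
  ultimately show "\<exists>e :: nat \<Rightarrow> real.
            (\<forall>n. 0 < e n \<and> e n < 1) \<and> e \<longlonglongrightarrow> 0 \<and>
            (\<forall>n. \<exists>g::complex \<Rightarrow> complex.
               g analytic_on ball 0 R \<and>
               disk_norm R g \<le> 1 \<and> disk_norm 1 g \<le> ereal (e n) \<and>
               (\<forall>z. 1 < cmod z \<and> cmod z < R \<longrightarrow>
                  cmod (g z) = e n powr alpha R z \<and>
                  elog (cmod (g z)) = ereal (alpha R z) * elog (e n)))"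
    using e by (intro exI[of _ e]) auto
qed

end
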